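(* The map $g\partial f\mapsto\partial^*(g\partial f)$, $f,g\in\mathcal C$, where $\partial^*(g\partial f)\in\mathcal C^*$ is the functional $u\mapsto-\langle g\partial f,\partial u\rangle_{\mathcal H}=-\int_X g\,d\Gamma(f,u)$, extends continuously to a bounded linear operator $\partial^*:\mathcal H\to\mathcal C^*$ with $\|\partial^*v\|_{\mathcal C^*}\le\sqrt2\,\|v\|_{\mathcal H}$ for all $v\in\mathcal H$. Moreover, $\partial^*v(u)=-\langle v,\partial u\rangle_{\mathcal H}$ for any $u\in\mathcal C$ and any $v\in\mathcal H$.
   Context: $X$ is a locally compact separable metric space, $\mu$ a nonnegative Radon measure on $X$ with $\mu(U)>0$ for every nonempty open $U$, and $(\mathcal E,\mathcal F)$ a regular symmetric Dirichlet form on $L_2(X,\mu)$; $\mathcal E(f)=\mathcal E(f,f)$. $C_0(X)$ is the space of continuous compactly supported functions, $\mathcal C:=C_0(X)\cap\mathcal F$, normed by $\|f\|_{\mathcal C}:=\mathcal E(f)^{1/2}+\sup_X|f|$; $\mathcal B_b(X)$ is the space of bounded Borel functions. $\mathcal C^*$ is the dual of $\mathcal C$ with norm $\|w\|_{\mathcal C^*}=\sup\{|w(f)|:f\in\mathcal C,\|f\|_{\mathcal C}\le1\}$. Energy measures: for $g,h\in\mathcal C$, $\Gamma(g,h)$ is the unique finite signed Radon measure with $2\int_X f\,d\Gamma(g,h)=\mathcal E(fg,h)+\mathcal E(fh,g)-\mathcal E(gh,f)$ for all $f\in\mathcal C$; $\Gamma(g):=\Gamma(g,g)\ge0$. The space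 $\mathcal H$: on $\mathcal C\otimes\mathcal B_b(X)$ consider the nonnegative definite symmetric bilinear form determined by $\langle a\otimes b,c\otimes d\rangle_{\mathcal H}:=\int_X bd\,d\Gamma(a,c)$, with seminorm $\|\cdot\|_{\mathcal H}$. $\mathcal H$ is the Hilbert space completion of $\mathcal C\otimes\mathcal B_b(X)/\ker\|\cdot\|_{\mathcal H}$. For $f,g\in\mathcal C$, $\partial f:=f\otimes\mathbf 1\in\mathcal H$ and $g\partial f:=f\otimes g\in\mathcal H$. *)

theory Defs
  imports "HOL-Analysis.Analysis"
begin

section \<open>Radon measures and finite signed Radon measures\<close>

definition radon_measure :: "'a::metric_space measure \<Rightarrow> bool" where
  "radon_measure M \<longleftrightarrow>
     sets M = sets borel \<and>
     (\<forall>K. compact K \<longrightarrow> emeasure M K < \<infinity>) \<and>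
     (\<forall>B\<in>sets borel. emeasure M B = (SUP K\<in>{K. compact K \<and> K \<subseteq> B}. emeasure M K))"

text \<open>
  Signed measures are real-valued set functions; only their values on Borel sets matter.
  The Jordan decomposition of \<open>\<nu>\<close> consists of \<open>upper_variation \<nu>\<close> and \<open>lower_variation \<nu>\<close>.
  Negative values of \<open>\<nu> B\<close> are truncated by \<open>ennreal\<close>, which does not change the
  supremum because \<open>\<nu> {} = 0\<close>.
\<close>

definition upper_variation :: "('a::metric_space set \<Rightarrow> real) \<Rightarrow> 'a measure" where
  "upper_variation \<nu> =
     measure_of UNIV (sets borel) (\<lambda>A. SUP B\<in>{B\<in>sets borel. B \<subseteq> A}. ennreal (\<nu> B))"

definition lower_variation :: "('a::metric_space set \<Rightarrow> real) \<Rightarrow> 'a measure" where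
  "lower_variation \<nu> = upper_variation (\<lambda>A. - \<nu> A)"

definition finite_signed_radon_measure :: "('a::metric_space set \<Rightarrow> real) \<Rightarrow> bool" where
  "finite_signed_radon_measure \<nu> \<longleftrightarrow>
     \<nu> {} = 0 \<and>
     (\<forall>A :: nat \<Rightarrow> 'a set. range A \<subseteq> sets borel \<longrightarrow> disjoint_family A \<longrightarrow>
        (\<lambda>i. \<nu> (A i)) sums \<nu> (\<Union>i. A i)) \<and>
     finite_measure (upper_variation \<nu>) \<and> radon_measure (upper_variation \<nu>) \<and>
     finite_measure (lower_variation \<nu>) \<and> radon_measure (lower_variation \<nu>)"

definition signed_integral :: "('a::metric_space set \<Rightarrow> real) \<Rightarrow> ('a \<Rightarrow> real) \<Rightarrow> real" where
  "signed_integral \<nu> f =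
     (LINT x|upper_variation \<nu>. f x) - (LINT x|lower_variation \<nu>. f x)"


section \<open>Function spaces\<close>

definition L2_functions :: "'a measure \<Rightarrow> ('a \<Rightarrow> real) set" where
  "L2_functions M = {f \<in> borel_measurable M. integrable M (\<lambda>x. (f x)\<^sup>2)}"

definition Cc_functions :: "('a::metric_space \<Rightarrow> real) set" where
  "Cc_functions = {f. continuous_on UNIV f \<and> compact (closure {x. f x \<noteq> 0})}"

definition bounded_borel_functions :: "('a::metric_space \<Rightarrow> real) set" where
  "bounded_borel_functions = {f \<in> borel_measurable borel. bounded (range f)}"

definition sup_norm :: "('a \<Rightarrow> real) \<Rightarrow> real" where
  "sup_norm f = (SUP x. \<bar>f x\<bar>)"


section \<open>Regular symmetric Dirichlet forms\<close>

text \<open>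
  Elements of \<open>L\<^sub>2(M)\<close> are represented by measurable functions. Accordingly the domain \<open>F\<close>
  is closed under passing to an almost everywhere equal measurable function, and the form \<open>E\<close>
  depends on its arguments (on \<open>F\<close>) only up to almost everywhere equality.
  The values of \<open>E\<close> outside of \<open>F\<close> are irrelevant.
\<close>

definition E1_norm ::
  "'a measure \<Rightarrow> (('a \<Rightarrow> real) \<Rightarrow> ('a \<Rightarrow> real) \<Rightarrow> real) \<Rightarrow> ('a \<Rightarrow> real) \<Rightarrow> real" where
  "E1_norm M E f = sqrt (E f f + (LINT x|M. (f x)\<^sup>2))"

definition symmetric_form ::
  "'a measure \<Rightarrow> (('a \<Rightarrow> real) \<Rightarrow> ('a \<Rightarrow> real) \<Rightarrow> real) \<Rightarrow> ('a \<Rightarrow> real) set \<Rightarrow> bool" where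
  "symmetric_form M E F \<longleftrightarrow>
     F \<subseteq> L2_functions M \<and>
     (\<forall>f\<in>F. \<forall>g\<in>borel_measurable M. (AE x in M. f x = g x) \<longrightarrow> g \<in> F) \<and>
     (\<forall>f\<in>F. \<forall>g\<in>F. \<forall>h\<in>F. (AE x in M. f x = g x) \<longrightarrow> E f h = E g h) \<and>
     (\<lambda>x. 0) \<in> F \<and>
     (\<forall>f\<in>F. \<forall>g\<in>F. (\<lambda>x. f x + g x) \<in> F) \<and>
     (\<forall>c. \<forall>f\<in>F. (\<lambda>x. c * f x) \<in> F) \<and>
     (\<forall>f\<in>F. \<forall>g\<in>F. \<forall>h\<in>F. E (\<lambda>x. f x + g x) h = E f h + E g h) \<and>
     (\<forall>c. \<forall>f\<in>F. \<forall>h\<in>F. E (\<lambda>x. c * f x) h = c * E f h) \<and>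
     (\<forall>f\<in>F. \<forall>g\<in>F. E f g = E g f) \<and>
     (\<forall>f\<in>F. 0 \<le> E f f) \<and>
     (\<forall>f\<in>L2_functions M. \<forall>\<epsilon>>0. \<exists>g\<in>F. sqrt (LINT x|M. (f x - g x)\<^sup>2) < \<epsilon>)"

definition closed_form ::
  "'a measure \<Rightarrow> (('a \<Rightarrow> real) \<Rightarrow> ('a \<Rightarrow> real) \<Rightarrow> real) \<Rightarrow> ('a \<Rightarrow> real) set \<Rightarrow> bool" where
  "closed_form M E F \<longleftrightarrow>
     (\<forall>u :: nat \<Rightarrow> 'a \<Rightarrow> real.
        range u \<subseteq> F \<longrightarrow>
        (\<forall>\<epsilon>>0. \<exists>N. \<forall>m\<ge>N. \<forall>n\<ge>N. E1_norm M E (\<lambda>x. u m x - u n x) < \<epsilon>) \<longrightarrow>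
        (\<exists>v\<in>F. (\<lambda>n. E1_norm M E (\<lambda>x. u n x - v x)) \<longlonglongrightarrow> 0))"

definition markovian_form ::
  "(('a \<Rightarrow> real) \<Rightarrow> ('a \<Rightarrow> real) \<Rightarrow> real) \<Rightarrow> ('a \<Rightarrow> real) set \<Rightarrow> bool" where
  "markovian_form E F \<longleftrightarrow>
     (\<forall>u\<in>F. (\<lambda>x. min (max (u x) 0) 1) \<in> F \<and>
        E (\<lambda>x. min (max (u x) 0) 1) (\<lambda>x. min (max (u x) 0) 1) \<le> E u u)"

definition dirichlet_form ::
  "'a measure \<Rightarrow> (('a \<Rightarrow> real) \<Rightarrow> ('a \<Rightarrow> real) \<Rightarrow> real) \<Rightarrow> ('a \<Rightarrow> real) set \<Rightarrow> bool" where
  "dirichlet_form M E F \<longleftrightarrow> symmetric_form M E F \<and> closed_form M E F \<and> markovian_form E F"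

definition core_C :: "('a::metric_space \<Rightarrow> real) set \<Rightarrow> ('a \<Rightarrow> real) set" where
  "core_C F = Cc_functions \<inter> F"

definition regular_form ::
  "'a::metric_space measure \<Rightarrow> (('a \<Rightarrow> real) \<Rightarrow> ('a \<Rightarrow> real) \<Rightarrow> real) \<Rightarrow> ('a \<Rightarrow> real) set \<Rightarrow> bool"
  where
  "regular_form M E F \<longleftrightarrow>
     (\<forall>f\<in>F. \<forall>\<epsilon>>0. \<exists>g\<in>core_C F. E1_norm M E (\<lambda>x. f x - g x) < \<epsilon>) \<and>
     (\<forall>f\<in>Cc_functions. \<forall>\<epsilon>>0. \<exists>g\<in>core_C F. sup_norm (\<lambda>x. f x - g x) < \<epsilon>)"


section \<open>The normed space C and its dual\<close>

definition C_norm :: "(('a \<Rightarrow> real) \<Rightarrow> ('a \<Rightarrow> real) \<Rightarrow> real) \<Rightarrow> ('a \<Rightarrow> real) \<Rightarrow> real" where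
  "C_norm E f = sqrt (E f f) + sup_norm f"

text \<open>
  Functionals on \<open>core_C F\<close> are functions on all of \<open>'a \<Rightarrow> real\<close>
  whose values outside of \<open>core_C F\<close> are irrelevant.
\<close>

definition C_dual ::
  "(('a::metric_space \<Rightarrow> real) \<Rightarrow> ('a \<Rightarrow> real) \<Rightarrow> real) \<Rightarrow> ('a \<Rightarrow> real) set
     \<Rightarrow> (('a \<Rightarrow> real) \<Rightarrow> real) set" where
  "C_dual E F =
     {w. (\<forall>f\<in>core_C F. \<forall>g\<in>core_C F. w (\<lambda>x. f x + g x) = w f + w g) \<and>
         (\<forall>c. \<forall>f\<in>core_C F. w (\<lambda>x. c * f x) = c * w f) \<and>
         (\<exists>K. \<forall>f\<in>core_C F. \<bar>w f\<bar> \<le> K * C_norm E f)}"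

definition C_dual_norm ::
  "(('a::metric_space \<Rightarrow> real) \<Rightarrow> ('a \<Rightarrow> real) \<Rightarrow> real) \<Rightarrow> ('a \<Rightarrow> real) set
     \<Rightarrow> (('a \<Rightarrow> real) \<Rightarrow> real) \<Rightarrow> real" where
  "C_dual_norm E F w = Sup {\<bar>w f\<bar> |f. f \<in> core_C F \<and> C_norm E f \<le> 1}"

definition bounded_operator_to_C_dual ::
  "(('a::metric_space \<Rightarrow> real) \<Rightarrow> ('a \<Rightarrow> real) \<Rightarrow> real) \<Rightarrow> ('a \<Rightarrow> real) set
     \<Rightarrow> ('h::real_normed_vector \<Rightarrow> ('a \<Rightarrow> real) \<Rightarrow> real) \<Rightarrow> bool" where
  "bounded_operator_to_C_dual E F D \<longleftrightarrow>
     (\<forall>v. D v \<in> C_dual E F) \<and>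
     (\<forall>v w. \<forall>u\<in>core_C F. D (v + w) u = D v u + D w u) \<and>
     (\<forall>c v. \<forall>u\<in>core_C F. D (c *\<^sub>R v) u = c * D v u) \<and>
     (\<exists>K. \<forall>v. C_dual_norm E F (D v) \<le> K * norm v)"


section \<open>Energy measures and the Hilbert space H\<close>

text \<open>
  \<open>\<Gamma> g h\<close> is the mutual energy measure of \<open>g, h\<close>. For a regular Dirichlet form the
  condition determines \<open>\<Gamma> g h\<close> on Borel sets, since \<open>core_C F\<close> is uniformly dense in
  \<open>Cc_functions\<close>.
\<close>

definition energy_measures ::
  "(('a::metric_space \<Rightarrow> real) \<Rightarrow> ('a \<Rightarrow> real) \<Rightarrow> real) \<Rightarrow> ('a \<Rightarrow> real) set
     \<Rightarrow> (('a \<Rightarrow> real) \<Rightarrow> ('a \<Rightarrow> real) \<Rightarrow> 'a set \<Rightarrow> real) \<Rightarrow> bool" where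
  "energy_measures E F \<Gamma> \<longleftrightarrow>
     (\<forall>g\<in>core_C F. \<forall>h\<in>core_C F.
        finite_signed_radon_measure (\<Gamma> g h) \<and>
        (\<forall>f\<in>core_C F. 2 * signed_integral (\<Gamma> g h) f =
           E (\<lambda>x. f x * g x) h + E (\<lambda>x. f x * h x) g - E (\<lambda>x. g x * h x) f))"

text \<open>
  A Hilbert space completion of the tensor product of \<open>core_C F\<close> and
  \<open>bounded_borel_functions\<close> modulo the kernel of the seminorm is a complete inner product space
  \<open>'h\<close> together with a linear map from the tensor product, i.e. a bilinear map \<open>\<tau>\<close>
  (with \<open>\<tau> a b\<close> standing for the class of the elementary tensor of \<open>a\<close> and \<open>b\<close>),
  that preserves the inner product and has dense range.
\<close>

definition energy_hilbert_completion ::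
  "('a::metric_space \<Rightarrow> real) set \<Rightarrow> (('a \<Rightarrow> real) \<Rightarrow> ('a \<Rightarrow> real) \<Rightarrow> 'a set \<Rightarrow> real)
     \<Rightarrow> (('a \<Rightarrow> real) \<Rightarrow> ('a \<Rightarrow> real) \<Rightarrow> 'h::{real_inner, complete_space}) \<Rightarrow> bool" where
  "energy_hilbert_completion F \<Gamma> \<tau> \<longleftrightarrow>
     (\<forall>a\<in>core_C F. \<forall>a'\<in>core_C F. \<forall>b\<in>bounded_borel_functions.
        \<tau> (\<lambda>x. a x + a' x) b = \<tau> a b + \<tau> a' b) \<and>
     (\<forall>c. \<forall>a\<in>core_C F. \<forall>b\<in>bounded_borel_functions. \<tau> (\<lambda>x. c * a x) b = c *\<^sub>R \<tau> a b) \<and>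
     (\<forall>a\<in>core_C F. \<forall>b\<in>bounded_borel_functions. \<forall>b'\<in>bounded_borel_functions.
        \<tau> a (\<lambda>x. b x + b' x) = \<tau> a b + \<tau> a b') \<and>
     (\<forall>c. \<forall>a\<in>core_C F. \<forall>b\<in>bounded_borel_functions. \<tau> a (\<lambda>x. c * b x) = c *\<^sub>R \<tau> a b) \<and>
     (\<forall>a\<in>core_C F. \<forall>c\<in>core_C F. \<forall>b\<in>bounded_borel_functions. \<forall>d\<in>bounded_borel_functions.
        \<tau> a b \<bullet> \<tau> c d = signed_integral (\<Gamma> a c) (\<lambda>x. b x * d x)) \<and>
     closure (span {\<tau> a b |a b. a \<in> core_C F \<and> b \<in> bounded_borel_functions}) = UNIV"

definition gradient :: "(('a \<Rightarrow> real) \<Rightarrow> ('a \<Rightarrow> real) \<Rightarrow> 'h) \<Rightarrow> ('a \<Rightarrow> real) \<Rightarrow> 'h" where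
  "gradient \<tau> f = \<tau> f (\<lambda>x. 1)"

definition times_gradient ::
  "(('a \<Rightarrow> real) \<Rightarrow> ('a \<Rightarrow> real) \<Rightarrow> 'h) \<Rightarrow> ('a \<Rightarrow> real) \<Rightarrow> ('a \<Rightarrow> real) \<Rightarrow> 'h" where
  "times_gradient \<tau> g f = \<tau> f g"

end

theory Submission
  imports Defs
begin

text \<open>
  The operator is given by its last property: put \<open>D v u = - (v \<bullet> gradient \<tau> u)\<close>. Linearity and
  the formula on \<open>g \<partial>f\<close> are then immediate, and by the Cauchy-Schwarz inequality the norm bound
  follows once the gradient is bounded on the core, that is, once the total mass of the energy
  measure satisfies \<open>\<Gamma>(u,u)(X) \<le> C E(u,u)\<close>. The lemma \<open>energy_measure_total_le\<close> proves this with
  \<open>C = 1\<close>, which is better than the constant \<open>2\<close> that \<open>sqrt 2\<close> stands for.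

  The bound on the mass comes from the Markov property. Testing the energy measure with a function \<open>f\<close> of the core, \<open>0 \<le> f \<le> 1\<close>, that equals \<open>1\<close> on the
  support of \<open>u\<close> gives \<open>\<integral> f d\<Gamma>(u,u) = E(u,u) - E(u\<^sup>2,f) / 2\<close>. Raising \<open>f\<close> where it is already maximal
  cannot lower the energy, because truncation undoes the change; hence \<open>E(u\<^sup>2,f) \<ge> 0\<close>
  (\<open>form_nonneg_if_max_on_support\<close>). Making \<open>f\<close> equal to \<open>1\<close> on larger and larger
  compact sets yields the bound.

  The term \<open>E(u\<^sup>2,f)\<close> is meaningful only if \<open>u\<^sup>2\<close> is in the domain, and this is the main technical
  point (\<open>square_in_domain\<close>). For \<open>0 \<le> u \<le> 1\<close>, cut the graph of \<open>u\<close> horizontally into slices of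
  height \<open>1 / n\<close>. A lower slice is maximal where a higher one is nonzero, so any two slices have
  nonnegative mutual energy by the same principle. Therefore a combination of slices with
  coefficients bounded by \<open>C\<close> has energy at most \<open>C\<^sup>2 E(u,u)\<close>. Riemann sums for \<open>u\<^sup>2\<close> are such
  combinations, and the difference of a Riemann sum and a refinement of it has coefficients of
  size at most \<open>2 / n\<close>. So the dyadic Riemann sums are a Cauchy sequence, and since
  the form is closed, their limit \<open>u\<^sup>2\<close> is in the domain. Scaling and splitting into positive and
  negative parts reduce a bounded \<open>u\<close> to this case.
\<close>

section \<open>Horizontal slices of a function and Riemann sums for its square\<close>

text \<open>
  The part of \<open>u\<close> between the heights \<open>k / n\<close> and \<open>(k + 1) / n\<close>. It is a difference of two
  truncations of \<open>u\<close>, the operation that a Dirichlet form controls.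
\<close>

definition slice :: "('a \<Rightarrow> real) \<Rightarrow> nat \<Rightarrow> nat \<Rightarrow> 'a \<Rightarrow> real" where
  "slice u n k x = min (u x) (real (Suc k) / n) - min (u x) (real k / n)"

lemma slice_nonneg: "0 \<le> slice u n k x"
proof -
  have "real k / n \<le> real (Suc k) / n" by (simp add: divide_right_mono)
  then show ?thesis unfolding slice_def by linarith
qed

lemma less_if_slice_nonzero: "slice u n k x \<noteq> 0 \<Longrightarrow> real k / n < u x"
  using divide_right_mono[of "real k" "real (Suc k)" "real n"]
  unfolding slice_def by (simp add: min_def split: if_splits)

lemma sum_slice:
  assumes "0 \<le> u x" "u x \<le> 1" "0 < n"
  shows "(\<Sum>k<n. slice u n k x) = u x"
  using sum_lessThan_telescope[of "\<lambda>k. min (u x) (real k / n)" n] assms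
  by (simp add: slice_def)

text \<open>
  The slices are nonnegative with sum \<open>u\<close>, so a combination of them is a weighted average
  of its coefficients times \<open>u\<close>. Only the slices that do not vanish at \<open>x\<close> matter, which is what
  makes the pointwise error of \<open>square_approx\<close> small.
\<close>

lemma abs_slice_combination_le:
  assumes "0 \<le> u x" "u x \<le> 1" "0 < n" "\<And>k. k < n \<Longrightarrow> slice u n k x \<noteq> 0 \<Longrightarrow> \<bar>d k\<bar> \<le> C"
  shows "\<bar>\<Sum>k<n. d k * slice u n k x\<bar> \<le> C * u x"
proof -
  have "\<bar>\<Sum>k<n. d k * slice u n k x\<bar> \<le> (\<Sum>k<n. \<bar>d k * slice u n k x\<bar>)"
    by (rule sum_abs)
  also have "\<dots> \<le> (\<Sum>k<n. C * slice u n k x)"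
  proof (rule sum_mono)
    fix k assume "k \<in> {..<n}"
    then show "\<bar>d k * slice u n k x\<bar> \<le> C * slice u n k x"
      using assms(4)[of k] slice_nonneg[of u n k x]
      by (cases "slice u n k x = 0") (auto simp: abs_mult intro: mult_right_mono)
  qed
  also have "\<dots> = C * u x"
    using sum_slice[of u x n] assms by (simp add: sum_distrib_left[symmetric])
  finally show ?thesis .
qed

lemma slice_refine:
  assumes "0 < p"
  shows "slice u n j x = (\<Sum>k\<in>{j*p..<j*p+p}. slice u (n*p) k x)"
proof -
  have "(\<Sum>k\<in>{j*p..<j*p+p}. slice u (n*p) k x)
      = min (u x) (real (j*p+p) / real (n*p)) - min (u x) (real (j*p) / real (n*p))"
    unfolding slice_def
    using sum_Suc_diff'[of "j*p" "j*p+p" "\<lambda>k. min (u x) (real k / real (n*p))"] by simp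
  moreover have "real (j*p+p) / real (n*p) = real (Suc j) / real n"
  proof -
    have "real (j*p+p) = real (Suc j) * real p" by (simp add: algebra_simps)
    then show ?thesis using assms by simp
  qed
  moreover have "real (j*p) / real (n*p) = real j / real n" using assms by simp
  ultimately show ?thesis by (simp add: slice_def)
qed

text \<open>
  A Riemann sum of \<open>u\<^sup>2 = \<integral> 2 t d(min u t)\<close> over \<open>0 \<le> t \<le> 1\<close>, with the left end points of the
  heights as sample points.
\<close>

definition square_approx :: "('a \<Rightarrow> real) \<Rightarrow> nat \<Rightarrow> 'a \<Rightarrow> real" where
  "square_approx u n x = (\<Sum>k<n. (2 * real k / n) * slice u n k x)"

text \<open>
  Two Riemann sums can only be compared as combinations of the same slices. Cutting every
  slice into \<open>p\<close> parts, the part with index \<open>k\<close> inherits the coefficient of the coarse slice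
  \<open>k div p\<close>.
\<close>

lemma square_approx_refine:
  assumes "0 < p"
  shows "square_approx u n x = (\<Sum>k<n*p. (2 * real (k div p) / n) * slice u (n*p) k x)"
proof -
  have "square_approx u n x
      = (\<Sum>j<n. \<Sum>k\<in>{j*p..<j*p+p}. (2 * real (k div p) / n) * slice u (n*p) k x)"
    unfolding square_approx_def
  proof (rule sum.cong[OF refl])
    fix j
    have "k div p = j" if "k \<in> {j*p..<j*p+p}" for k
    proof -
      from that have "k = (k - j*p) + j*p" "k - j*p < p" by auto
      then show ?thesis using assms by (metis div_less div_mult_self3 add.commute add_0 less_not_refl)
    qed
    then show "(2 * real j / n) * slice u n j x
      = (\<Sum>k\<in>{j*p..<j*p+p}. (2 * real (k div p) / n) * slice u (n*p) k x)"
      by (simp add: slice_refine[OF assms, of u n j x] sum_distrib_left)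
  qed
  also have "\<dots> = (\<Sum>k<n*p. (2 * real (k div p) / n) * slice u (n*p) k x)"
    by (rule sum.nat_group)
  finally show ?thesis .
qed

text \<open>
  Telescoping writes \<open>u\<^sup>2\<close> as a combination of slices with coefficients
  \<open>min u ((k+1)/n) + min u (k/n)\<close>. Where slice \<open>k\<close> is nonzero, \<open>u\<close> exceeds \<open>k/n\<close>, and this
  coefficient lies between \<open>2k/n\<close> and \<open>2k/n + 1/n\<close>.
\<close>

lemma square_approx_error:
  assumes u: "0 \<le> u x" "u x \<le> 1" and n: "0 < n"
  shows "\<bar>(u x)\<^sup>2 - square_approx u n x\<bar> \<le> 1 / n * u x"
proof -
  let ?m = "\<lambda>k. min (u x) (real k / n)"
  have "(u x)\<^sup>2 = (\<Sum>k<n. (?m (Suc k))\<^sup>2 - (?m k)\<^sup>2)"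
    using sum_lessThan_telescope[of "\<lambda>k. (?m k)\<^sup>2" n] u n by simp
  also have "\<dots> = (\<Sum>k<n. (?m (Suc k) + ?m k) * slice u n k x)"
    by (simp add: slice_def power2_eq_square algebra_simps)
  finally have "(u x)\<^sup>2 - square_approx u n x
      = (\<Sum>k<n. (?m (Suc k) + ?m k - 2 * real k / n) * slice u n k x)"
    by (simp add: square_approx_def sum_subtractf[symmetric] left_diff_distrib)
  also have "\<bar>\<dots>\<bar> \<le> 1 / n * u x"
  proof (rule abs_slice_combination_le)
    fix k assume "slice u n k x \<noteq> 0"
    then have "real k / n < u x" by (rule less_if_slice_nonzero)
    moreover have "real (Suc k) / n = real k / n + 1 / n" by (simp add: add_divide_distrib)
    moreover have "2 * real k / n = real k / n + real k / n" by (simp add: add_divide_distrib)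
    moreover have "0 < 1 / real n" using n by simp
    ultimately show "\<bar>?m (Suc k) + ?m k - 2 * real k / n\<bar> \<le> 1 / n" by linarith
  qed (use u n in auto)
  finally show ?thesis .
qed

section \<open>Bilinear algebra of a Dirichlet form\<close>

locale dirichlet =
  fixes M :: "'a measure"
    and E :: "('a \<Rightarrow> real) \<Rightarrow> ('a \<Rightarrow> real) \<Rightarrow> real"
    and F :: "('a \<Rightarrow> real) set"
  assumes dirichlet: "dirichlet_form M E F"
begin

lemma sym_form: "symmetric_form M E F"
  and closed: "closed_form M E F"
  and markov: "markovian_form E F"
  using dirichlet by (auto simp: dirichlet_form_def)

lemma symmetric_form_conjuncts:
  shows "F \<subseteq> L2_functions M"
    and "\<forall>f\<in>F. \<forall>g\<in>borel_measurable M. (AE x in M. f x = g x) \<longrightarrow> g \<in> F"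
    and "(\<lambda>x. 0) \<in> F"
    and "\<forall>f\<in>F. \<forall>g\<in>F. (\<lambda>x. f x + g x) \<in> F"
    and "\<forall>c. \<forall>f\<in>F. (\<lambda>x. c * f x) \<in> F"
    and "\<forall>f\<in>F. \<forall>g\<in>F. \<forall>h\<in>F. E (\<lambda>x. f x + g x) h = E f h + E g h"
    and "\<forall>c. \<forall>f\<in>F. \<forall>h\<in>F. E (\<lambda>x. c * f x) h = c * E f h"
    and "\<forall>f\<in>F. \<forall>g\<in>F. E f g = E g f"
    and "\<forall>f\<in>F. 0 \<le> E f f"
  using sym_form unfolding symmetric_form_def by - (elim conjE, assumption)+

lemmas domain_AE = symmetric_form_conjuncts(2)[rule_format]
  and zero_in_domain = symmetric_form_conjuncts(3)
  and add_in_domain = symmetric_form_conjuncts(4)[rule_format]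
  and scale_in_domain = symmetric_form_conjuncts(5)[rule_format]
  and form_add = symmetric_form_conjuncts(6)[rule_format]
  and form_scale = symmetric_form_conjuncts(7)[rule_format]
  and form_sym = symmetric_form_conjuncts(8)[rule_format]
  and form_nonneg = symmetric_form_conjuncts(9)[rule_format]

lemma domain_L2:
  assumes "f \<in> F"
  shows "f \<in> borel_measurable M" "integrable M (\<lambda>x. (f x)\<^sup>2)"
  using symmetric_form_conjuncts(1) assms by (auto simp: L2_functions_def)

lemma clamp_in_domain: "u \<in> F \<Longrightarrow> (\<lambda>x. min (max (u x) 0) 1) \<in> F"
  by (rule markov[unfolded markovian_form_def, rule_format, THEN conjunct1])

lemma form_clamp_le: "u \<in> F \<Longrightarrow>
     E (\<lambda>x. min (max (u x) 0) 1) (\<lambda>x. min (max (u x) 0) 1) \<le> E u u"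
  by (rule markov[unfolded markovian_form_def, rule_format, THEN conjunct2])

lemma diff_in_domain:
  assumes "f \<in> F" "g \<in> F" shows "(\<lambda>x. f x - g x) \<in> F"
  using add_in_domain[OF assms(1) scale_in_domain[OF assms(2), of "-1"]] by simp

lemma form_add_right:
  assumes "f \<in> F" "g \<in> F" "h \<in> F"
  shows "E h (\<lambda>x. f x + g x) = E h f + E h g"
  using form_sym[OF assms(3) add_in_domain[OF assms(1,2)]] form_add[OF assms]
    form_sym[OF assms(1,3)] form_sym[OF assms(2,3)] by simp

lemma form_scale_right:
  assumes "f \<in> F" "h \<in> F"
  shows "E h (\<lambda>x. c * f x) = c * E h f"
  using form_sym[OF assms(2) scale_in_domain[OF assms(1), of c]] form_scale[OF assms, of c]
    form_sym[OF assms] by simp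

lemma form_zero: "E (\<lambda>x. 0) (\<lambda>x. 0) = 0"
  using form_scale[OF zero_in_domain zero_in_domain, of 0] by simp

lemma combination_in_domain:
  fixes w :: "nat \<Rightarrow> 'a \<Rightarrow> real"
  assumes "\<And>k. w k \<in> F"
  shows "(\<lambda>x. \<Sum>k<n. d k * w k x) \<in> F"
  by (induction n) (simp_all add: zero_in_domain add_in_domain scale_in_domain assms)

lemma form_combination:
  fixes w :: "nat \<Rightarrow> 'a \<Rightarrow> real"
  assumes w: "\<And>k. w k \<in> F" and h: "h \<in> F"
  shows "E (\<lambda>x. \<Sum>k<n. d k * w k x) h = (\<Sum>k<n. d k * E (w k) h)"
proof (induction n)
  case 0
  show ?case using form_scale[OF zero_in_domain h, of 0] by simp
next
  case (Suc n)
  then show ?case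
    by (simp add: form_add form_scale combination_in_domain scale_in_domain w h)
qed

lemma form_combination2:
  fixes w :: "nat \<Rightarrow> 'a \<Rightarrow> real"
  assumes w: "\<And>k. w k \<in> F"
  shows "E (\<lambda>x. \<Sum>k<n. d k * w k x) (\<lambda>x. \<Sum>k<n. d k * w k x)
       = (\<Sum>j<n. \<Sum>k<n. d j * d k * E (w j) (w k))"
proof -
  have "E (w j) (\<lambda>x. \<Sum>k<n. d k * w k x) = (\<Sum>k<n. d k * E (w j) (w k))" for j
    using form_combination[OF w, OF w[of j], where n = n and d = d]
      form_sym[OF w combination_in_domain[of w, OF w]] form_sym[OF w w] by simp
  then show ?thesis
    by (simp add: form_combination[OF w combination_in_domain[of w, OF w]] sum_distrib_left
        mult.assoc)
qed

section \<open>Consequences of the Markov property\<close>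

text \<open>
  Adding \<open>t w\<close> to \<open>f\<close> only raises \<open>f\<close> where it already has its maximal value \<open>c\<close>, so cutting off
  at \<open>c\<close> gives back \<open>f\<close>. Hence \<open>E f f \<le> E (f + t w) (f + t w)\<close> by the Markov property, and the
  derivative at \<open>t = 0\<close> is nonnegative.
\<close>

lemma form_nonneg_if_max_on_support:
  assumes f: "f \<in> F" and w: "w \<in> F" and c: "c > 0"
    and range: "\<And>x. 0 \<le> f x" "\<And>x. f x \<le> c" "\<And>x. 0 \<le> w x"
    and supp: "\<And>x. w x \<noteq> 0 \<Longrightarrow> f x = c"
  shows "0 \<le> E f w"
proof -
  define g where "g = (\<lambda>x. inverse c * f x)"
  have g: "g \<in> F" unfolding g_def by (rule scale_in_domain[OF f])
  have *: "0 \<le> 2 * E g w + t * E w w" if t: "t > 0" for t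
  proof -
    have tw: "(\<lambda>x. t * w x) \<in> F" by (rule scale_in_domain[OF w])
    have "min (max (g x + t * w x) 0) 1 = g x" for x
    proof (cases "w x = 0")
      case True
      then show ?thesis using range(1,2)[of x] c by (auto simp: g_def field_simps)
    next
      case False
      then have "g x = 1" using supp[of x] c by (simp add: g_def)
      then show ?thesis using t range(3)[of x] by auto
    qed
    then have "E g g \<le> E (\<lambda>x. g x + t * w x) (\<lambda>x. g x + t * w x)"
      using form_clamp_le[OF add_in_domain[OF g tw]] by simp
    also have "\<dots> = E g g + t * (2 * E g w + t * E w w)"
      using g w tw by (simp add: form_add form_add_right form_scale form_scale_right
          add_in_domain form_sym[of w g] algebra_simps)
    finally show ?thesis using t by (simp add: zero_le_mult_iff)
  qed
  have "((\<lambda>t. 2 * E g w + t * E w w) \<longlongrightarrow> 2 * E g w + 0 * E w w) (at_right 0)"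
    by (intro tendsto_intros)
  moreover have "\<forall>\<^sub>F t in at_right 0. 0 \<le> 2 * E g w + t * E w w"
    using * by (auto simp: eventually_at_right_less intro: eventually_mono[OF eventually_at_right_less])
  ultimately have "0 \<le> 2 * E g w + 0 * E w w"
    by (rule tendsto_lowerbound) simp
  then show ?thesis
    using c form_scale[OF f w, of "inverse c"] by (simp add: g_def zero_le_mult_iff)
qed

lemma min_in_domain:
  assumes u: "u \<in> F" and "\<And>x. 0 \<le> u x" and c: "0 \<le> c"
  shows "(\<lambda>x. min (u x) c) \<in> F"
proof (cases "c = 0")
  case True
  then have "(\<lambda>x. min (u x) c) = (\<lambda>x. 0)" using assms(2) by (simp add: fun_eq_iff)
  then show ?thesis using zero_in_domain by simp
next
  case False
  then have "c > 0" using c by simp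
  have "(\<lambda>x. c * min (max (inverse c * u x) 0) 1) \<in> F"
    by (rule scale_in_domain[OF clamp_in_domain[OF scale_in_domain[OF u]]])
  moreover have "c * min (max (inverse c * u x) 0) 1 = min (u x) c" for x
    using \<open>c > 0\<close> assms(2)[of x] by (auto simp: min_def max_def field_simps)
  ultimately show ?thesis by simp
qed

lemma slice_in_domain:
  assumes "u \<in> F" "\<And>x. 0 \<le> u x"
  shows "slice u n k \<in> F"
  unfolding slice_def[abs_def] using assms by (intro diff_in_domain min_in_domain) auto

text \<open>
  A lower slice has its maximal value \<open>1 / n\<close> wherever a higher slice is nonzero.
\<close>

lemma form_slice_nonneg:
  assumes u: "u \<in> F" "\<And>x. 0 \<le> u x" and n: "0 < n"
  shows "0 \<le> E (slice u n j) (slice u n k)"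
proof -
  have lt: "0 \<le> E (slice u n j) (slice u n k)" if "j < k" for j k
  proof (rule form_nonneg_if_max_on_support[where c = "1 / n"])
    fix x
    have le: "real (Suc j) / n \<le> real k / n" "real k / n \<le> real (Suc k) / n"
      using that by (auto intro!: divide_right_mono)
    have eq: "real (Suc j) / n = real j / n + 1 / n" by (simp add: add_divide_distrib)
    have pos: "0 < 1 / real n" using n by simp
    show "slice u n j x \<le> 1 / n"
      unfolding slice_def eq using pos by linarith
    show "slice u n j x = 1 / n" if "slice u n k x \<noteq> 0"
      using less_if_slice_nonzero[OF that] le(1) pos unfolding slice_def eq by linarith
  qed (use u n in \<open>auto intro: slice_in_domain slice_nonneg\<close>)
  show ?thesis
    using lt[of j k] lt[of k j] form_nonneg[OF slice_in_domain[OF u]]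
      form_sym[OF slice_in_domain[OF u] slice_in_domain[OF u], of n k n j]
    by (cases j k rule: linorder_cases) auto
qed

text \<open>
  Because the Gram matrix of the slices has nonnegative entries, replacing every coefficient
  by its bound \<open>C\<close> can only increase the energy, and the slices add up to \<open>u\<close>.
\<close>

lemma form_slice_combination_le:
  assumes u: "u \<in> F" "\<And>x. 0 \<le> u x" "\<And>x. u x \<le> 1" and n: "0 < n"
    and d: "\<And>k. k < n \<Longrightarrow> \<bar>d k\<bar> \<le> C"
  shows "E (\<lambda>x. \<Sum>k<n. d k * slice u n k x) (\<lambda>x. \<Sum>k<n. d k * slice u n k x) \<le> C\<^sup>2 * E u u"
proof -
  let ?w = "slice u n"
  have w: "?w k \<in> F" for k by (rule slice_in_domain[OF u(1,2)])
  have "E (\<lambda>x. \<Sum>k<n. d k * ?w k x) (\<lambda>x. \<Sum>k<n. d k * ?w k x)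
      = (\<Sum>j<n. \<Sum>k<n. d j * d k * E (?w j) (?w k))"
    by (rule form_combination2[OF w])
  also have "\<dots> \<le> (\<Sum>j<n. \<Sum>k<n. C * C * E (?w j) (?w k))"
  proof (intro sum_mono mult_right_mono)
    fix j k assume "j \<in> {..<n}" "k \<in> {..<n}"
    then have "\<bar>d j\<bar> * \<bar>d k\<bar> \<le> C * C"
      using d[of j] d[of k] by (intro mult_mono) auto
    then show "d j * d k \<le> C * C" by (simp add: abs_mult[symmetric])
  qed (rule form_slice_nonneg[OF u(1,2) n])
  also have "\<dots> = C\<^sup>2 * (\<Sum>j<n. \<Sum>k<n. 1 * 1 * E (?w j) (?w k))"
    by (simp add: sum_distrib_left power2_eq_square)
  also have "(\<Sum>j<n. \<Sum>k<n. 1 * 1 * E (?w j) (?w k))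
      = E (\<lambda>x. \<Sum>k<n. 1 * ?w k x) (\<lambda>x. \<Sum>k<n. 1 * ?w k x)"
    using form_combination2[OF w, where n = n and d = "\<lambda>_. 1"] by simp
  also have "(\<lambda>x. \<Sum>k<n. 1 * ?w k x) = u"
    using sum_slice[of u _ n] u n by auto
  finally show ?thesis .
qed

lemma E1_norm_slice_combination_le:
  assumes u: "u \<in> F" "\<And>x. 0 \<le> u x" "\<And>x. u x \<le> 1" and n: "0 < n" and C: "0 \<le> C"
    and d: "\<And>k. k < n \<Longrightarrow> \<bar>d k\<bar> \<le> C"
  shows "E1_norm M E (\<lambda>x. \<Sum>k<n. d k * slice u n k x) \<le> C * E1_norm M E u"
proof -
  let ?f = "\<lambda>x. \<Sum>k<n. d k * slice u n k x"
  have f: "?f \<in> F"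
    using combination_in_domain[of "slice u n"] slice_in_domain[OF u(1,2)] by blast
  have "(?f x)\<^sup>2 \<le> C\<^sup>2 * (u x)\<^sup>2" for x
    using abs_slice_combination_le[of u x n d C] u n d C
    by (metis abs_le_square_iff abs_of_nonneg mult_nonneg_nonneg power_mult_distrib)
  then have "(LINT x|M. (?f x)\<^sup>2) \<le> (LINT x|M. C\<^sup>2 * (u x)\<^sup>2)"
    using domain_L2(2)[OF f] domain_L2(2)[OF u(1)] by (intro integral_mono) auto
  then have "E ?f ?f + (LINT x|M. (?f x)\<^sup>2) \<le> C\<^sup>2 * (E u u + (LINT x|M. (u x)\<^sup>2))"
    using form_slice_combination_le[OF u n, of d C] d by (simp add: distrib_left)
  then have "sqrt (E ?f ?f + (LINT x|M. (?f x)\<^sup>2)) \<le> sqrt (C\<^sup>2 * (E u u + (LINT x|M. (u x)\<^sup>2)))"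
    by (rule real_sqrt_le_mono)
  then show ?thesis using C by (simp add: E1_norm_def real_sqrt_mult)
qed

lemma square_approx_in_domain:
  "u \<in> F \<Longrightarrow> (\<And>x. 0 \<le> u x) \<Longrightarrow> square_approx u n \<in> F"
  unfolding square_approx_def[abs_def]
  by (intro combination_in_domain slice_in_domain)

lemma E1_norm_square_approx_diff_le:
  assumes u: "u \<in> F" "\<And>x. 0 \<le> u x" "\<And>x. u x \<le> 1" and n: "0 < n" and p: "0 < p"
  shows "E1_norm M E (\<lambda>x. square_approx u (n*p) x - square_approx u n x)
    \<le> 2 / n * E1_norm M E u"
proof -
  let ?d = "\<lambda>k. 2 * real k / real (n*p) - 2 * real (k div p) / real n"
  have "square_approx u (n*p) x - square_approx u n x = (\<Sum>k<n*p. ?d k * slice u (n*p) k x)" for x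
    unfolding square_approx_refine[OF p, of u n x] square_approx_def[of u "n*p"]
      sum_subtractf[symmetric] by (simp add: left_diff_distrib)
  moreover have "\<bar>?d k\<bar> \<le> 2 / n" for k
  proof -
    \<comment> \<open>The fine sample point exceeds the coarse one by the position of \<open>k\<close> within its block.\<close>
    have eq: "?d k = 2 * (real (k mod p) / p) / n"
    proof -
      have "real k = real (k div p) * p + real (k mod p)"
        by (metis of_nat_add of_nat_mult div_mult_mod_eq)
      then show ?thesis using n p by (simp add: field_simps)
    qed
    have "real (k mod p) / p \<le> 1" using p by simp
    then have "2 * (real (k mod p) / p) / n \<le> 2 / n"
      by (intro divide_right_mono) auto
    then show ?thesis unfolding eq by simp
  qed
  ultimately show ?thesis
    using E1_norm_slice_combination_le[OF u, of "n*p" "2/n" ?d] n p by simp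
qed

section \<open>Squares of bounded functions in the domain\<close>

lemma E1_norm_minus_commute:
  assumes "f \<in> F" "g \<in> F"
  shows "E1_norm M E (\<lambda>x. f x - g x) = E1_norm M E (\<lambda>x. g x - f x)"
proof -
  have h: "(\<lambda>x. g x - f x) \<in> F" by (rule diff_in_domain[OF assms(2,1)])
  have eq: "(\<lambda>x. f x - g x) = (\<lambda>x. -1 * (g x - f x))" by auto
  have "E (\<lambda>x. f x - g x) (\<lambda>x. f x - g x) = E (\<lambda>x. g x - f x) (\<lambda>x. g x - f x)"
    unfolding eq using form_scale[OF h scale_in_domain[OF h], of "-1" "-1"]
      form_scale_right[OF h h, of "-1"] by simp
  then show ?thesis by (simp add: E1_norm_def power2_commute)
qed

text \<open>
  The Riemann sums on dyadic grids are a Cauchy sequence for \<open>E1_norm\<close>, so closedness gives a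
  limit \<open>v\<close> in the domain. They converge to \<open>u\<^sup>2\<close> in mean square, so \<open>v\<close> and \<open>u\<^sup>2\<close> agree almost
  everywhere.
\<close>

lemma square_in_domain_unit:
  assumes u: "u \<in> F" "\<And>x. 0 \<le> u x" "\<And>x. u x \<le> 1"
  shows "(\<lambda>x. (u x)\<^sup>2) \<in> F"
proof -
  define e where "e n = square_approx u (2 ^ n)" for n
  have e: "e n \<in> F" for n
    unfolding e_def by (rule square_approx_in_domain[OF u(1,2)])
  have diff: "E1_norm M E (\<lambda>x. e m x - e n x) \<le> 2 / 2 ^ n * E1_norm M E u" if "n \<le> m" for m n
    using E1_norm_square_approx_diff_le[OF u, of "2^n" "2^(m-n)"] that
    by (simp add: e_def power_add[symmetric])
  have pow: "(\<lambda>n. 1 / 2 ^ n :: real) \<longlonglongrightarrow> 0"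
    using LIMSEQ_power_zero[of "1 / 2 :: real"] by (simp add: power_one_over)
  have lim: "(\<lambda>n. 2 / 2 ^ n * E1_norm M E u) \<longlonglongrightarrow> 0"
    using tendsto_mult[OF pow tendsto_const, of "2 * E1_norm M E u"] by simp
  have "\<exists>N. \<forall>m\<ge>N. \<forall>n\<ge>N. E1_norm M E (\<lambda>x. e m x - e n x) < \<epsilon>" if "\<epsilon> > 0" for \<epsilon>
  proof -
    obtain N where N: "\<And>n. n \<ge> N \<Longrightarrow> 2 / 2 ^ n * E1_norm M E u < \<epsilon>"
      using order_tendstoD(2)[OF lim \<open>\<epsilon> > 0\<close>] by (auto simp: eventually_sequentially)
    have "E1_norm M E (\<lambda>x. e m x - e n x) < \<epsilon>" if "m \<ge> N" "n \<ge> N" for m n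
      using diff[of n m] diff[of m n] N[OF that(1)] N[OF that(2)]
        E1_norm_minus_commute[OF e e, of m n] by (cases "n \<le> m") auto
    then show ?thesis by blast
  qed
  then obtain v where v: "v \<in> F" and ev: "(\<lambda>n. E1_norm M E (\<lambda>x. e n x - v x)) \<longlonglongrightarrow> 0"
    using closed[unfolded closed_form_def, rule_format, of e] e by blast
  have [measurable]: "u \<in> borel_measurable M" "v \<in> borel_measurable M" "\<And>n. e n \<in> borel_measurable M"
    using u(1) v e domain_L2(1) by auto
  let ?r = "\<lambda>x. ((u x)\<^sup>2 - v x)\<^sup>2"
  let ?b = "\<lambda>n. 2 * (1 / 2 ^ n)\<^sup>2 * (LINT x|M. (u x)\<^sup>2) + 2 * (E1_norm M E (\<lambda>x. e n x - v x))\<^sup>2"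
  have err: "?r x \<le> 2 * (1 / 2 ^ n)\<^sup>2 * (u x)\<^sup>2 + 2 * (e n x - v x)\<^sup>2" for x n
  proof -
    have "\<bar>(u x)\<^sup>2 - e n x\<bar> \<le> 1 / 2 ^ n * u x"
      using square_approx_error[of u x "2^n"] u by (simp add: e_def)
    then have "((u x)\<^sup>2 - e n x)\<^sup>2 \<le> (1 / 2 ^ n * u x)\<^sup>2"
      using power_mono[of "\<bar>(u x)\<^sup>2 - e n x\<bar>" "1 / 2 ^ n * u x" 2] by simp
    moreover have "(a + b)\<^sup>2 \<le> 2 * a\<^sup>2 + 2 * b\<^sup>2" for a b :: real
      using zero_le_power2[of "a - b"] by (simp add: power2_eq_square algebra_simps)
    from this[of "(u x)\<^sup>2 - e n x" "e n x - v x"]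
    have "?r x \<le> 2 * ((u x)\<^sup>2 - e n x)\<^sup>2 + 2 * (e n x - v x)\<^sup>2" by simp
    ultimately show ?thesis unfolding power_mult_distrib by linarith
  qed
  have int: "integrable M (\<lambda>x. 2 * (1 / 2 ^ n)\<^sup>2 * (u x)\<^sup>2 + 2 * (e n x - v x)\<^sup>2)" for n :: nat
    using domain_L2(2)[OF u(1)] domain_L2(2)[OF diff_in_domain[OF e v]] by auto
  have r_int: "integrable M ?r"
    by (rule Bochner_Integration.integrable_bound[OF int[of 0]])
      (use err[of _ 0] in \<open>auto intro: order_trans[OF _ abs_ge_self]\<close>)
  have "(LINT x|M. ?r x) \<le> ?b n" for n
  proof -
    have "(LINT x|M. ?r x) \<le> (LINT x|M. 2 * (1 / 2 ^ n)\<^sup>2 * (u x)\<^sup>2 + 2 * (e n x - v x)\<^sup>2)"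
      by (rule integral_mono[OF r_int int err])
    also have "\<dots> = 2 * (1 / 2 ^ n)\<^sup>2 * (LINT x|M. (u x)\<^sup>2) + 2 * (LINT x|M. (e n x - v x)\<^sup>2)"
      using domain_L2(2)[OF u(1)] domain_L2(2)[OF diff_in_domain[OF e v]] by simp
    also have "(LINT x|M. (e n x - v x)\<^sup>2) \<le> (E1_norm M E (\<lambda>x. e n x - v x))\<^sup>2"
      using form_nonneg[OF diff_in_domain[OF e v], of n] by (simp add: E1_norm_def)
    finally show ?thesis by simp
  qed
  moreover have "?b \<longlonglongrightarrow> 2 * 0\<^sup>2 * (LINT x|M. (u x)\<^sup>2) + 2 * 0\<^sup>2"
    by (intro tendsto_intros ev pow)
  ultimately have "(LINT x|M. ?r x) \<le> 0"
    using LIMSEQ_le_const[of ?b] by auto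
  moreover have "0 \<le> (LINT x|M. ?r x)" by simp
  ultimately have "(LINT x|M. ?r x) = 0" by linarith
  then have "AE x in M. ?r x = 0"
    by (subst (asm) integral_nonneg_eq_0_iff_AE[OF r_int]) auto
  then have "AE x in M. v x = (u x)\<^sup>2" by eventually_elim simp
  then show ?thesis using domain_AE[OF v] by simp
qed

lemma square_in_domain_nonneg:
  assumes u: "u \<in> F" "\<And>x. 0 \<le> u x" "\<And>x. u x \<le> c" and c: "0 < c"
  shows "(\<lambda>x. (u x)\<^sup>2) \<in> F"
proof -
  have "(\<lambda>x. (inverse c * u x)\<^sup>2) \<in> F"
    using u c by (intro square_in_domain_unit scale_in_domain) (auto simp: field_simps)
  from scale_in_domain[OF this, of "c\<^sup>2"] show ?thesis
    using c by (simp add: field_simps)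
qed

text \<open>
  The squares of the positive and of the negative part of \<open>u\<close> add up to \<open>u\<^sup>2\<close>.
\<close>

lemma square_in_domain:
  assumes u: "u \<in> F" and c: "\<And>x. \<bar>u x\<bar> \<le> c" "0 < c"
  shows "(\<lambda>x. (u x)\<^sup>2) \<in> F"
proof -
  have pos: "(\<lambda>x. (max (v x) 0)\<^sup>2) \<in> F" if v: "v \<in> F" "\<And>x. v x \<le> c" for v
  proof (rule square_in_domain_nonneg[OF _ _ _ c(2)])
    have "(\<lambda>x. c * min (max (inverse c * v x) 0) 1) \<in> F"
      by (rule scale_in_domain[OF clamp_in_domain[OF scale_in_domain[OF v(1)]]])
    moreover have "c * min (max (inverse c * v x) 0) 1 = max (v x) 0" for x
      using c(2) v(2)[of x] by (auto simp: min_def max_def field_simps)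
    ultimately show "(\<lambda>x. max (v x) 0) \<in> F" by simp
  qed (use v c in auto)
  \<comment> \<open>The negative part is the positive part of \<open>-1 * u\<close>, written with the scaling of the form.\<close>
  have "(\<lambda>x. (max (u x) 0)\<^sup>2 + (max (-1 * u x) 0)\<^sup>2) \<in> F"
    using c(1) by (intro add_in_domain pos scale_in_domain u)
      (auto intro: order_trans[OF abs_ge_self] order_trans[OF abs_ge_minus_self])
  moreover have "(max (u x) 0)\<^sup>2 + (max (-1 * u x) 0)\<^sup>2 = (u x)\<^sup>2" for x
    by (simp add: max_def)
  ultimately show ?thesis by simp
qed

end

section \<open>Continuous functions with compact support\<close>

lemma Cc_functions_bounded:
  assumes "f \<in> Cc_functions"
  obtains c where "0 < c" "\<And>x. \<bar>f x\<bar> \<le> c"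
proof -
  let ?S = "closure {x. f x \<noteq> 0}"
  have "compact (f ` ?S)"
    using assms by (auto simp: Cc_functions_def intro!: compact_continuous_image intro: continuous_on_subset)
  then obtain c where c: "0 < c" "\<And>y. y \<in> f ` ?S \<Longrightarrow> \<bar>y\<bar> \<le> c"
    using compact_imp_bounded[of "f ` ?S"] unfolding bounded_pos real_norm_def by blast
  have "\<bar>f x\<bar> \<le> c" for x
    using c closure_subset[of "{x. f x \<noteq> 0}"] by (cases "f x = 0") auto
  then show ?thesis using that c(1) by blast
qed

lemma Cc_functions_imp_bounded_borel:
  assumes "f \<in> Cc_functions" shows "f \<in> bounded_borel_functions"
proof -
  obtain c where "\<And>x. \<bar>f x\<bar> \<le> c" using Cc_functions_bounded[OF assms] by blast
  then have "bounded (range f)" unfolding bounded_iff by auto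
  moreover have "f \<in> borel_measurable borel"
    using assms by (auto simp: Cc_functions_def intro: borel_measurable_continuous_onI)
  ultimately show ?thesis by (simp add: bounded_borel_functions_def)
qed

lemma abs_le_sup_norm:
  assumes "\<And>x. \<bar>f x\<bar> \<le> c" shows "\<bar>f x\<bar> \<le> sup_norm f"
proof -
  have "bdd_above (range (\<lambda>x. \<bar>f x\<bar>))"
    by (rule bdd_aboveI[of _ c]) (use assms in auto)
  then show ?thesis unfolding sup_norm_def
    using cSUP_upper[OF UNIV_I, of "\<lambda>x. \<bar>f x\<bar>" x] by simp
qed

lemma compact_closure_if_subset_compact:
  fixes A :: "'a::metric_space set"
  assumes "A \<subseteq> L" "compact L" shows "compact (closure A)"
proof -
  have "closure A \<subseteq> L" using assms by (simp add: closure_minimal compact_imp_closed)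
  then show ?thesis using compact_Int_closed[OF assms(2) closed_closure[of A]]
    by (simp add: inf.absorb2)
qed

lemma locally_compact_cutoff:
  fixes K :: "'a::metric_space set"
  assumes "locally_compact_space (euclidean :: 'a topology)" and K: "compact K"
  obtains \<phi> where "\<phi> \<in> Cc_functions" "\<And>x. \<bar>\<phi> x\<bar> \<le> 1" "\<And>x. x \<in> K \<Longrightarrow> \<phi> x = 1"
proof -
  have "Hausdorff_space (euclidean :: 'a topology)"
    by (simp add: metrizable_imp_Hausdorff_space metrizable_space_euclidean)
  then obtain U L where UL: "open U" "compact L" "K \<subseteq> U" "U \<subseteq> L"
    using assms locally_compact_space_compact_closed_compact[of "euclidean :: 'a topology"]
    by auto
  have "normal_space (euclidean :: 'a topology)"
    by (simp add: metrizable_imp_normal_space metrizable_space_euclidean)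
  moreover have "disjnt (- U) K" using UL(3) by (auto simp: disjnt_def)
  ultimately obtain \<phi> where \<phi>: "continuous_map euclidean (top_of_set {0..1::real}) \<phi>"
      "\<phi> ` (- U) \<subseteq> {0}" "\<phi> ` K \<subseteq> {1}"
    using Urysohn_lemma[of euclidean "- U" K 0 1] UL(1) compact_imp_closed[OF K]
    by (auto simp: closed_Compl)
  have "{x. \<phi> x \<noteq> 0} \<subseteq> L" using \<phi>(2) UL(4) by auto
  then have "compact (closure {x. \<phi> x \<noteq> 0})"
    using UL(2) by (rule compact_closure_if_subset_compact)
  moreover have "continuous_on UNIV \<phi>" and range: "\<And>x. \<phi> x \<in> {0..1}"
    using \<phi>(1) by (auto simp: continuous_map_in_subtopology)
  ultimately have "\<phi> \<in> Cc_functions" by (simp add: Cc_functions_def)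
  then show ?thesis using that range \<phi>(3) by fastforce
qed

section \<open>Total mass of energy measures\<close>

locale regular_dirichlet = dirichlet M E F
  for M :: "'a::metric_space measure"
    and E :: "('a \<Rightarrow> real) \<Rightarrow> ('a \<Rightarrow> real) \<Rightarrow> real"
    and F :: "('a \<Rightarrow> real) set" +
  assumes locally_compact: "locally_compact_space (euclidean :: 'a topology)"
    and regular: "regular_form M E F"
begin

text \<open>
  Regularity gives a member \<open>g\<close> of the core within \<open>1/2\<close> of a topological cutoff function;
  then \<open>2 g \<ge> 1\<close> on \<open>K\<close>, and truncating \<open>2 g\<close> to the unit interval stays in the core.
\<close>

lemma core_cutoff:
  assumes "compact K"
  obtains f where "f \<in> core_C F" "\<And>x. 0 \<le> f x" "\<And>x. f x \<le> 1" "\<And>x. x \<in> K \<Longrightarrow> f x = 1"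
proof -
  obtain \<phi> where \<phi>: "\<phi> \<in> Cc_functions" "\<And>x. \<bar>\<phi> x\<bar> \<le> 1" "\<And>x. x \<in> K \<Longrightarrow> \<phi> x = 1"
    using locally_compact_cutoff[OF locally_compact assms] by blast
  obtain g where g: "g \<in> core_C F" "sup_norm (\<lambda>x. \<phi> x - g x) < 1 / 2"
    using regular[unfolded regular_form_def, THEN conjunct2, rule_format, OF \<phi>(1), of "1 / 2"]
    by auto
  then have gF: "g \<in> F" and gC: "g \<in> Cc_functions" by (auto simp: core_C_def)
  obtain c where c: "\<And>x. \<bar>g x\<bar> \<le> c" using Cc_functions_bounded[OF gC] by blast
  have close: "\<bar>\<phi> x - g x\<bar> < 1 / 2" for x
  proof -
    have "\<bar>\<phi> y - g y\<bar> \<le> 1 + c" for y using \<phi>(2)[of y] c[of y] by linarith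
    from abs_le_sup_norm[of "\<lambda>x. \<phi> x - g x", OF this, of x] g(2) show ?thesis by linarith
  qed
  define f where "f = (\<lambda>x. min (max (2 * g x) 0) 1)"
  have "f \<in> F" unfolding f_def by (rule clamp_in_domain[OF scale_in_domain[OF gF]])
  moreover have "continuous_on UNIV f"
    using gC unfolding f_def Cc_functions_def
    by (intro continuous_on_min continuous_on_max continuous_on_mult continuous_on_const) simp
  moreover have "compact (closure {x. f x \<noteq> 0})"
  proof (rule compact_closure_if_subset_compact)
    show "{x. f x \<noteq> 0} \<subseteq> closure {x. g x \<noteq> 0}"
      using closure_subset[of "{x. g x \<noteq> 0}"] by (auto simp: f_def)
  qed (use gC in \<open>simp add: Cc_functions_def\<close>)
  ultimately have "f \<in> core_C F" by (simp add: core_C_def Cc_functions_def)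
  moreover have "f x = 1" if "x \<in> K" for x
    using close[of x] \<phi>(3)[OF that] unfolding f_def by linarith
  ultimately show ?thesis using that[of f] by (auto simp: f_def)
qed

text \<open>
  For a cutoff function \<open>f\<close> that is \<open>1\<close> on the support of \<open>u\<close>, the product \<open>f u\<close> is \<open>u\<close>, and the
  defining identity becomes \<open>2 \<integral> f d\<Gamma>(u,u) = 2 E(u,u) - E(u\<^sup>2,f)\<close>. Here \<open>E(u\<^sup>2,f) \<ge> 0\<close>, since \<open>f\<close> is
  maximal where \<open>u\<^sup>2\<close> is nonzero. If \<open>f\<close> is also \<open>1\<close> on a large compact set, inner regularity of
  the upper variation makes \<open>\<integral> (1 - f) d\<Gamma>(u,u)\<close> at most \<open>\<epsilon>\<close>.
\<close>

lemma energy_measure_total_le: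
  assumes \<Gamma>: "energy_measures E F \<Gamma>" and u: "u \<in> core_C F"
  shows "signed_integral (\<Gamma> u u) (\<lambda>x. 1) \<le> E u u"
proof (rule field_le_epsilon)
  fix \<epsilon> :: real assume "0 < \<epsilon>"
  define P Q where "P = upper_variation (\<Gamma> u u)" and "Q = lower_variation (\<Gamma> u u)"
  have fin: "finite_measure P" "finite_measure Q" and radon: "radon_measure P"
    using \<Gamma> u by (auto simp: energy_measures_def finite_signed_radon_measure_def P_def Q_def)
  interpret P: finite_measure P by (rule fin)
  interpret Q: finite_measure Q by (rule fin)
  have sets[measurable_cong]: "sets P = sets borel" "sets Q = sets borel"
    and space: "space P = UNIV" "space Q = UNIV"
    by (simp_all add: P_def Q_def lower_variation_def upper_variation_def
        sets.sigma_sets_eq[of borel, simplified])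
  have "\<exists>K. compact K \<and> measure P UNIV - \<epsilon> < measure P K"
  proof (rule ccontr)
    assume no: "\<not> (\<exists>K. compact K \<and> measure P UNIV - \<epsilon> < measure P K)"
    then have le: "measure P K \<le> measure P UNIV - \<epsilon>" if "compact K" for K
      using no that by (auto simp: not_less)
    have "emeasure P UNIV = (SUP K\<in>{K. compact K \<and> K \<subseteq> UNIV}. emeasure P K)"
      using radon[unfolded radon_measure_def, THEN conjunct2, THEN conjunct2, rule_format, of UNIV]
      by simp
    also have "\<dots> \<le> ennreal (measure P UNIV - \<epsilon>)"
      by (rule SUP_least) (auto simp: P.emeasure_eq_measure intro!: ennreal_leI le)
    finally have "measure P UNIV \<le> measure P UNIV - \<epsilon>"
      using le[OF compact_empty] by (simp add: P.emeasure_eq_measure)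
    then show False using \<open>0 < \<epsilon>\<close> by simp
  qed
  then obtain K where K: "compact K" "measure P UNIV - \<epsilon> < measure P K" by blast
  have uF: "u \<in> F" and uC: "u \<in> Cc_functions" using u by (auto simp: core_C_def)
  have "compact (K \<union> closure {x. u x \<noteq> 0})"
    using uC K(1) by (auto simp: Cc_functions_def)
  from core_cutoff[OF this] obtain f where f: "f \<in> core_C F" "\<And>x. 0 \<le> f x" "\<And>x. f x \<le> 1"
      "\<And>x. x \<in> K \<union> closure {x. u x \<noteq> 0} \<Longrightarrow> f x = 1" by metis
  have f1: "f x = 1" if "u x \<noteq> 0" for x
    using f(4)[of x] that closure_subset[of "{x. u x \<noteq> 0}"] by auto
  have fF: "f \<in> F" using f(1) by (simp add: core_C_def)
  obtain c where c: "0 < c" "\<And>x. \<bar>u x\<bar> \<le> c" using Cc_functions_bounded[OF uC] by blast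
  have sq: "(\<lambda>x. (u x)\<^sup>2) \<in> F" by (rule square_in_domain[OF uF c(2,1)])
  have "0 \<le> E f (\<lambda>x. (u x)\<^sup>2)"
    by (rule form_nonneg_if_max_on_support[OF fF sq zero_less_one]) (use f f1 in auto)
  moreover have "(\<lambda>x. f x * u x) = u"
  proof
    fix x show "f x * u x = u x" using f1[of x] by (cases "u x = 0") auto
  qed
  then have "2 * signed_integral (\<Gamma> u u) f = 2 * E u u - E (\<lambda>x. (u x)\<^sup>2) f"
    using \<Gamma> u f(1) unfolding energy_measures_def by (simp add: power2_eq_square)
  ultimately have f_le: "signed_integral (\<Gamma> u u) f \<le> E u u"
    using form_sym[OF fF sq] by simp
  have meas: "f \<in> borel_measurable borel"
    using f(1) Cc_functions_imp_bounded_borel by (auto simp: core_C_def bounded_borel_functions_def)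
  then have [measurable]: "f \<in> borel_measurable P" "f \<in> borel_measurable Q"
    by (simp_all cong: measurable_cong_sets add: sets)
  have int: "integrable P f" "integrable Q f"
    using f(2,3) by (auto intro!: P.integrable_const_bound[where B = 1]
        Q.integrable_const_bound[where B = 1])
  have KP: "K \<in> sets P" using K(1) by (simp add: sets compact_imp_closed)
  have "(LINT x|P. 1 - f x) \<le> (LINT x|P. indicator (UNIV - K) x)"
  proof (rule integral_mono)
    show "integrable P (\<lambda>x. indicator (UNIV - K) x :: real)"
      using KP space by (intro P.integrable_const_bound[where B = 1]) (auto simp: indicator_def sets)
    show "1 - f x \<le> indicator (UNIV - K) x" for x
      using f(2)[of x] f(4)[of x] by (auto simp: indicator_def)
  qed (use int in auto)
  also have "\<dots> = measure P UNIV - measure P K"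
    using P.finite_measure_compl[OF KP] space by simp
  finally have "(LINT x|P. 1 - f x) \<le> \<epsilon>" using K(2) by simp
  \<comment> \<open>The lower variation enters with a minus sign, so there a bound by zero is enough.\<close>
  moreover have "0 \<le> (LINT x|Q. 1 - f x)" using f(3) by simp
  moreover have "signed_integral (\<Gamma> u u) (\<lambda>x. 1) - signed_integral (\<Gamma> u u) f
      = (LINT x|P. 1 - f x) - (LINT x|Q. 1 - f x)"
    using int by (simp add: signed_integral_def P_def[symmetric] Q_def[symmetric])
  ultimately show "signed_integral (\<Gamma> u u) (\<lambda>x. 1) \<le> E u u + \<epsilon>" using f_le by simp
qed

text \<open>
  The supremum norm of a member of the core is nonnegative because the function is bounded;
  for an unbounded function the value of the supremum would be unspecified.
\<close>

lemma energy_le_C_norm: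
  assumes "u \<in> core_C F"
  shows "sqrt (E u u) \<le> C_norm E u"
proof -
  obtain c where "\<And>x. \<bar>u x\<bar> \<le> c"
    using Cc_functions_bounded[of u] assms by (auto simp: core_C_def)
  from abs_le_sup_norm[where f = u and x = undefined, OF this] have "0 \<le> sup_norm u"
    by linarith
  then show ?thesis by (simp add: C_norm_def)
qed

lemma zero_in_core: "(\<lambda>x. 0) \<in> core_C F"
  using zero_in_domain by (simp add: core_C_def Cc_functions_def)

lemma C_dual_norm_le:
  assumes "\<And>u. u \<in> core_C F \<Longrightarrow> \<bar>w u\<bar> \<le> K * C_norm E u" and "0 \<le> K"
  shows "C_dual_norm E F w \<le> K"
  unfolding C_dual_norm_def
proof (rule cSup_least)
  have "C_norm E (\<lambda>x. 0) \<le> 1" using form_zero by (simp add: C_norm_def sup_norm_def)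
  then show "{\<bar>w f\<bar> |f. f \<in> core_C F \<and> C_norm E f \<le> 1} \<noteq> {}" using zero_in_core by blast
next
  fix y assume "y \<in> {\<bar>w f\<bar> |f. f \<in> core_C F \<and> C_norm E f \<le> 1}"
  then obtain f where f: "y = \<bar>w f\<bar>" "f \<in> core_C F" "C_norm E f \<le> 1" by blast
  then have "y \<le> K * C_norm E f" using assms(1) by simp
  also have "\<dots> \<le> K" using f(3) assms(2) by (simp add: mult_left_le)
  finally show "y \<le> K" .
qed

end

section \<open>The adjoint of the gradient\<close>

lemma energy_hilbert_completionD:
  assumes "energy_hilbert_completion F \<Gamma> \<tau>"
  shows "\<forall>a\<in>core_C F. \<forall>a'\<in>core_C F. \<forall>b\<in>bounded_borel_functions.
        \<tau> (\<lambda>x. a x + a' x) b = \<tau> a b + \<tau> a' b"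
    and "\<forall>c. \<forall>a\<in>core_C F. \<forall>b\<in>bounded_borel_functions. \<tau> (\<lambda>x. c * a x) b = c *\<^sub>R \<tau> a b"
    and "\<forall>a\<in>core_C F. \<forall>c\<in>core_C F. \<forall>b\<in>bounded_borel_functions. \<forall>d\<in>bounded_borel_functions.
        \<tau> a b \<bullet> \<tau> c d = signed_integral (\<Gamma> a c) (\<lambda>x. b x * d x)"
  using assms unfolding energy_hilbert_completion_def by - (elim conjE, assumption)+

lemma one_bounded_borel: "(\<lambda>x. 1) \<in> bounded_borel_functions"
  by (simp add: bounded_borel_functions_def)

theorem lemma3p1:
  fixes M :: "'a::metric_space measure"
    and E :: "('a \<Rightarrow> real) \<Rightarrow> ('a \<Rightarrow> real) \<Rightarrow> real"
    and F :: "('a \<Rightarrow> real) set"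
    and \<Gamma> :: "('a \<Rightarrow> real) \<Rightarrow> ('a \<Rightarrow> real) \<Rightarrow> 'a set \<Rightarrow> real"
    and \<tau> :: "('a \<Rightarrow> real) \<Rightarrow> ('a \<Rightarrow> real) \<Rightarrow> 'h::{real_inner, complete_space}"
  assumes "locally_compact_space (euclidean :: 'a topology)"
    and "separable_space (euclidean :: 'a topology)"
    and "radon_measure M"
    and "\<And>U. open U \<Longrightarrow> U \<noteq> {} \<Longrightarrow> emeasure M U > 0"
    and "dirichlet_form M E F"
    and "regular_form M E F"
    and "energy_measures E F \<Gamma>"
    and "energy_hilbert_completion F \<Gamma> \<tau>"
  shows "\<exists>D :: 'h \<Rightarrow> ('a \<Rightarrow> real) \<Rightarrow> real.
    bounded_operator_to_C_dual E F D \<and>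
    (\<forall>f\<in>core_C F. \<forall>g\<in>core_C F. \<forall>u\<in>core_C F.
       D (times_gradient \<tau> g f) u = - (times_gradient \<tau> g f \<bullet> gradient \<tau> u) \<and>
       D (times_gradient \<tau> g f) u = - signed_integral (\<Gamma> f u) g) \<and>
    (\<forall>v. C_dual_norm E F (D v) \<le> sqrt 2 * norm v) \<and>
    (\<forall>v. \<forall>u\<in>core_C F. D v u = - (v \<bullet> gradient \<tau> u))"
proof -
  interpret regular_dirichlet M E F
    using assms(1,5,6) by unfold_locales
  note \<tau> = energy_hilbert_completionD[OF assms(8), rule_format]
  let ?D = "\<lambda>v u. - (v \<bullet> gradient \<tau> u)"
  have grad: "norm (gradient \<tau> u) \<le> sqrt (E u u)" if "u \<in> core_C F" for u
    using energy_measure_total_le[OF assms(7) that]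
      \<tau>(3)[OF that that one_bounded_borel one_bounded_borel]
    by (simp add: gradient_def norm_eq_sqrt_inner)
  have grad_add: "gradient \<tau> (\<lambda>x. f x + g x) = gradient \<tau> f + gradient \<tau> g"
    if "f \<in> core_C F" "g \<in> core_C F" for f g
    using \<tau>(1)[OF that one_bounded_borel] by (simp only: gradient_def)
  have grad_scale: "gradient \<tau> (\<lambda>x. c * f x) = c *\<^sub>R gradient \<tau> f" if "f \<in> core_C F" for c f
    using \<tau>(2)[OF that one_bounded_borel] by (simp only: gradient_def)
  have bound: "\<bar>?D v u\<bar> \<le> sqrt 2 * norm v * C_norm E u" if u: "u \<in> core_C F" for v u
  proof -
    have "\<bar>?D v u\<bar> \<le> norm v * norm (gradient \<tau> u)"
      by (simp add: Cauchy_Schwarz_ineq2)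
    also have "\<dots> \<le> norm v * C_norm E u"
      using grad[OF u] energy_le_C_norm[OF u] by (intro mult_left_mono) auto
    also have "\<dots> \<le> sqrt 2 * (norm v * C_norm E u)"
    proof -
      have "0 \<le> norm v * C_norm E u"
        using order_trans[OF norm_ge_zero order_trans[OF grad energy_le_C_norm], OF u u] by simp
      from mult_right_mono[OF _ this, of 1 "sqrt 2"] show ?thesis by simp
    qed
    finally show ?thesis by (simp only: mult.assoc)
  qed
  have dual: "?D v \<in> C_dual E F" for v
    unfolding C_dual_def using bound[of _ v] by (auto simp: grad_add grad_scale inner_add_right)
  have dual_norm: "C_dual_norm E F (?D v) \<le> sqrt 2 * norm v" for v
    by (rule C_dual_norm_le) (use bound in auto)
  have "bounded_operator_to_C_dual E F ?D"
    unfolding bounded_operator_to_C_dual_def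
    using dual dual_norm by (auto simp: inner_add_left)
  moreover have "times_gradient \<tau> g f \<bullet> gradient \<tau> u = signed_integral (\<Gamma> f u) g"
    if "f \<in> core_C F" "g \<in> core_C F" "u \<in> core_C F" for f g u
    using \<tau>(3)[OF that(1,3) _ one_bounded_borel, of g] that(2)
      Cc_functions_imp_bounded_borel[of g]
    by (simp add: times_gradient_def gradient_def core_C_def)
  ultimately show ?thesis
    using dual_norm by (intro exI[of _ ?D]) auto
qed

end
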